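(* Let $H$ be a Hopf algebra, let $B=A^{coH}\subseteq A$ be an $H$-Hopf--Galois extension and let $\gamma$ be a 2-cocycle on $H$. The gauge group $\mathrm{Aut}_B(A_\gamma)$ of the twisted Hopf--Galois extension $B=A_\gamma^{coH_\gamma}\subseteq A_\gamma$ is isomorphic to the gauge group $\mathrm{Aut}_B(A)$ of the original Hopf--Galois extension.
   Context: $\Bbbk$ is a field, or the ring of formal power series in a variable over a field; $\otimes$ is over $\Bbbk$; algebras are unital and associative, algebra maps unital; sums in Sweedler notation are understood. A right $H$-comodule algebra $A$ has coaction $\delta:A\to A\otimes H$, $a\mapsto a_{(0)}\otimes a_{(1)}$, an algebra map. $B=A^{coH}=\{b\in A\mid\delta(b)=b\otimes1\}\subseteq A$ is an $H$-Hopf--Galois extension if $\chi:A\otimes_BA\to A\otimes H$, $a'\otimes_Ba\mapsto a'a_{(0)}\otimes a_{(1)}$, is bijective. Its gauge group is $$\mathrm{Aut}_B(A)=\{\Phi:A\to A\mid \Phi \text{ is an algebra map and an } H\text{-comodule map, } \Phi|_B=\mathrm{id}\},$$ with product $\Phi\cdot\Psi=\Psi\circ\Phi$. A 2-cocycle on $H$ is a convolution-invertible linear map $\gamma:H\otimes H\to\Bbbk$, with convolution inverse $\bar\gamma$, such that $\gamma(h\otimes1)=\varepsilon(h)=\gamma(1\otimes h)$ and $\gamma(g_{(1)}\otimes h_{(1)})\gamma(g_{(2)}h_{(2)}\otimes k)=\gamma(h_{(1)}\otimes k_{(1)})\gamma(g\otimes h_{(2)}k_{(2)})$ for all $g,h,k\in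 H$. The twisted Hopf algebra $H_\gamma$ is the coalgebra $H$ with product $h\cdot_\gamma k=\gamma(h_{(1)}\otimes k_{(1)})\,h_{(2)}k_{(2)}\,\bar\gamma(h_{(3)}\otimes k_{(3)})$. The right $H_\gamma$-comodule algebra $A_\gamma$ is the vector space $A$ with the same unit and the same coaction (regarded as an $H_\gamma$-coaction) and product $a\bullet_\gamma a'=a_{(0)}a'_{(0)}\,\bar\gamma(a_{(1)}\otimes a'_{(1)})$. The algebra $B$ is also the subalgebra of $H_\gamma$-coinvariants of $A_\gamma$, and it is known that $B\subseteq A_\gamma$ is $H_\gamma$-Hopf--Galois if and only if $B\subseteq A$ is $H$-Hopf--Galois. The group $\mathrm{Aut}_B(A_\gamma)$ is defined as $\mathrm{Aut}_B(A)$, with $(A_\gamma,H_\gamma)$ in place of $(A,H)$. *)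

theory Defs
  imports "HOL-Algebra.Group" "HOL-Library.Poly_Mapping"
    "HOL-Computational_Algebra.Formal_Power_Series"
begin

text \<open>
  Every \<open>\<k>\<close>-module is the whole of a type \<^typ>\<open>'v::ab_group_add\<close> together with an explicit
  scalar multiplication satisfying the library locale \<^locale>\<open>module\<close>. Products are explicit
  record components rather than type class operations, because a cocycle twist puts a second
  product on the same module.
\<close>

section \<open>The ground ring\<close>

definition field_or_power_series :: "'k::comm_ring_1 itself \<Rightarrow> 'f::field itself \<Rightarrow> bool" where
  "field_or_power_series _ _ \<longleftrightarrow>
     (\<forall>x::'k. x \<noteq> 0 \<longrightarrow> (\<exists>y. x * y = 1)) \<or>
     (\<exists>\<phi> :: 'k \<Rightarrow> 'f fps. bij \<phi> \<and> \<phi> 1 = 1 \<and>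
        (\<forall>x y. \<phi> (x + y) = \<phi> x + \<phi> y) \<and> (\<forall>x y. \<phi> (x * y) = \<phi> x * \<phi> y))"


section \<open>Free modules, quotients and tensor products\<close>

text \<open>
  \<^typ>\<open>'p \<Rightarrow>\<^sub>0 'k\<close> is the free \<open>\<k>\<close>-module on the set of all elements of \<^typ>\<open>'p\<close>. A tensor
  product is a quotient of such a free module, and its elements are the cosets.
\<close>

definition free_scale :: "'k::comm_ring_1 \<Rightarrow> ('p \<Rightarrow>\<^sub>0 'k) \<Rightarrow> ('p \<Rightarrow>\<^sub>0 'k)" where
  "free_scale c = Poly_Mapping.map ((*) c)"

abbreviation gen :: "'p \<Rightarrow> ('p \<Rightarrow>\<^sub>0 'k::comm_ring_1)" where
  "gen p \<equiv> Poly_Mapping.single p 1"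

definition coset_of :: "'v::ab_group_add set \<Rightarrow> 'v \<Rightarrow> 'v set" where
  "coset_of N x = {y. y - x \<in> N}"

definition rep :: "'v set \<Rightarrow> 'v" where
  "rep X = (SOME x. x \<in> X)"

definition linear_to_quotient ::
    "('k::comm_ring_1 \<Rightarrow> 'v::ab_group_add \<Rightarrow> 'v) \<Rightarrow> ('k \<Rightarrow> 'w::ab_group_add \<Rightarrow> 'w) \<Rightarrow> 'w set \<Rightarrow>
      ('v \<Rightarrow> 'w set) \<Rightarrow> bool" where
  "linear_to_quotient s t N f \<longleftrightarrow>
     (\<forall>x. f x \<in> range (coset_of N)) \<and>
     (\<forall>x y. f (x + y) = coset_of N (rep (f x) + rep (f y))) \<and>
     (\<forall>c x. f (s c x) = coset_of N (t c (rep (f x))))"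

definition module_bilinear ::
    "('k::comm_ring_1 \<Rightarrow> 'm::ab_group_add \<Rightarrow> 'm) \<Rightarrow> ('k \<Rightarrow> 'n::ab_group_add \<Rightarrow> 'n) \<Rightarrow>
      ('k \<Rightarrow> 'p::ab_group_add \<Rightarrow> 'p) \<Rightarrow> ('m \<Rightarrow> 'n \<Rightarrow> 'p) \<Rightarrow> bool" where
  "module_bilinear s t u f \<longleftrightarrow> (\<forall>x. module_hom t u (f x)) \<and> (\<forall>y. module_hom s u (\<lambda>x. f x y))"

definition tensor_relators ::
    "('k::comm_ring_1 \<Rightarrow> 'm::ab_group_add \<Rightarrow> 'm) \<Rightarrow> ('k \<Rightarrow> 'n::ab_group_add \<Rightarrow> 'n) \<Rightarrow>
      ('m \<times> 'n \<Rightarrow>\<^sub>0 'k) set" where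
  "tensor_relators s t =
     {gen (x + x', y) - gen (x, y) - gen (x', y) | x x' y. True} \<union>
     {gen (x, y + y') - gen (x, y) - gen (x, y') | x y y'. True} \<union>
     {gen (s c x, y) - free_scale c (gen (x, y)) | c x y. True} \<union>
     {gen (x, t c y) - free_scale c (gen (x, y)) | c x y. True}"

definition tensor_null ::
    "('k::comm_ring_1 \<Rightarrow> 'm::ab_group_add \<Rightarrow> 'm) \<Rightarrow> ('k \<Rightarrow> 'n::ab_group_add \<Rightarrow> 'n) \<Rightarrow>
      ('m \<times> 'n \<Rightarrow>\<^sub>0 'k) set" where
  "tensor_null s t = module.span free_scale (tensor_relators s t)"

definition tensor ::
    "('k::comm_ring_1 \<Rightarrow> 'm::ab_group_add \<Rightarrow> 'm) \<Rightarrow> ('k \<Rightarrow> 'n::ab_group_add \<Rightarrow> 'n) \<Rightarrow>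
      ('m \<times> 'n \<Rightarrow>\<^sub>0 'k) set set" where
  "tensor s t = range (coset_of (tensor_null s t))"

text \<open>The threefold tensor product, in which coassociativity is stated.\<close>

definition tensor_null3 ::
    "('k::comm_ring_1 \<Rightarrow> 'm::ab_group_add \<Rightarrow> 'm) \<Rightarrow> ('k \<Rightarrow> 'n::ab_group_add \<Rightarrow> 'n) \<Rightarrow>
      ('k \<Rightarrow> 'p::ab_group_add \<Rightarrow> 'p) \<Rightarrow> ('m \<times> 'n \<times> 'p \<Rightarrow>\<^sub>0 'k) set" where
  "tensor_null3 s t u = module.span free_scale (
     {gen (x + x', y, z) - gen (x, y, z) - gen (x', y, z) | x x' y z. True} \<union>
     {gen (x, y + y', z) - gen (x, y, z) - gen (x, y', z) | x y y' z. True} \<union>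
     {gen (x, y, z + z') - gen (x, y, z) - gen (x, y, z') | x y z z'. True} \<union>
     {gen (s c x, y, z) - free_scale c (gen (x, y, z)) | c x y z. True} \<union>
     {gen (x, t c y, z) - free_scale c (gen (x, y, z)) | c x y z. True} \<union>
     {gen (x, y, u c z) - free_scale c (gen (x, y, z)) | c x y z. True})"

text \<open>
  \<open>sweedler s f (\<Delta> h)\<close> is the sum usually written \<open>f (h\<^sub>(\<^sub>1\<^sub>), h\<^sub>(\<^sub>2\<^sub>))\<close>, with values in a module with scalar
  multiplication \<open>s\<close>. It is computed from an arbitrary representative of the given tensor; in all
  uses below \<open>f\<close> respects the relators (possibly only modulo the null submodule of the target, of
  which a coset is then taken), so that the choice is immaterial.
\<close>

definition sweedler ::
    "('k::comm_ring_1 \<Rightarrow> 'v::ab_group_add \<Rightarrow> 'v) \<Rightarrow> ('p \<Rightarrow> 'v) \<Rightarrow> ('p \<Rightarrow>\<^sub>0 'k) set \<Rightarrow> 'v" where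
  "sweedler s f X =
     (\<Sum>p \<in> Poly_Mapping.keys (rep X). s (Poly_Mapping.lookup (rep X) p) (f p))"


section \<open>Algebras, Hopf algebras, comodule algebras\<close>

record ('k, 'v) alg =
  scl :: "'k \<Rightarrow> 'v \<Rightarrow> 'v"
  mul :: "'v \<Rightarrow> 'v \<Rightarrow> 'v"
  unt :: 'v

record (overloaded) ('k, 'h) bialg = "('k::zero, 'h) alg" +
  comul :: "'h \<Rightarrow> ('h \<times> 'h \<Rightarrow>\<^sub>0 'k) set"
  counit :: "'h \<Rightarrow> 'k"

record (overloaded) ('k, 'h, 'a) comod_alg = "('k::zero, 'a) alg" +
  coact :: "'a \<Rightarrow> ('a \<times> 'h \<Rightarrow>\<^sub>0 'k) set"

definition k_algebra ::
    "('k::comm_ring_1, 'v::ab_group_add, 'z) alg_scheme \<Rightarrow> bool" where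
  "k_algebra A \<longleftrightarrow>
     module (scl A) \<and> module_bilinear (scl A) (scl A) (scl A) (mul A) \<and>
     (\<forall>x y z. mul A (mul A x y) z = mul A x (mul A y z)) \<and>
     (\<forall>x. mul A (unt A) x = x \<and> mul A x (unt A) = x)"

definition algebra_hom ::
    "('k::comm_ring_1, 'v::ab_group_add, 'z) alg_scheme \<Rightarrow>
      ('k, 'w::ab_group_add, 'y) alg_scheme \<Rightarrow> ('v \<Rightarrow> 'w) \<Rightarrow> bool" where
  "algebra_hom A C f \<longleftrightarrow>
     module_hom (scl A) (scl C) f \<and>
     (\<forall>x y. f (mul A x y) = mul C (f x) (f y)) \<and> f (unt A) = unt C"

text \<open>The product \<open>(a \<otimes> c)(a' \<otimes> c') = aa' \<otimes> cc'\<close> of two algebras.\<close>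

definition tensor_mul ::
    "('k::comm_ring_1, 'v::ab_group_add, 'z) alg_scheme \<Rightarrow>
      ('k, 'w::ab_group_add, 'y) alg_scheme \<Rightarrow>
      ('v \<times> 'w \<Rightarrow>\<^sub>0 'k) set \<Rightarrow> ('v \<times> 'w \<Rightarrow>\<^sub>0 'k) set \<Rightarrow> ('v \<times> 'w \<Rightarrow>\<^sub>0 'k) set" where
  "tensor_mul A C X Y = coset_of (tensor_null (scl A) (scl C))
     (sweedler free_scale (\<lambda>(a, c).
        sweedler free_scale (\<lambda>(a', c'). gen (mul A a a', mul C c c')) Y) X)"

text \<open>An algebra map \<open>D \<rightarrow> A \<otimes> C\<close>.\<close>

definition algebra_hom_to_tensor ::
    "('k::comm_ring_1, 'u::ab_group_add, 'x) alg_scheme \<Rightarrow>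
      ('k, 'v::ab_group_add, 'z) alg_scheme \<Rightarrow> ('k, 'w::ab_group_add, 'y) alg_scheme \<Rightarrow>
      ('u \<Rightarrow> ('v \<times> 'w \<Rightarrow>\<^sub>0 'k) set) \<Rightarrow> bool" where
  "algebra_hom_to_tensor D A C f \<longleftrightarrow>
     linear_to_quotient (scl D) free_scale (tensor_null (scl A) (scl C)) f \<and>
     (\<forall>x y. f (mul D x y) = tensor_mul A C (f x) (f y)) \<and>
     f (unt D) = coset_of (tensor_null (scl A) (scl C)) (gen (unt A, unt C))"

definition bialgebra :: "('k::comm_ring_1, 'h::ab_group_add, 'z) bialg_scheme \<Rightarrow> bool" where
  "bialgebra H \<longleftrightarrow>
     k_algebra H \<and>
     algebra_hom_to_tensor H H H (comul H) \<and>
     module_hom (scl H) (*) (counit H) \<and>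
     (\<forall>g h. counit H (mul H g h) = counit H g * counit H h) \<and> counit H (unt H) = 1 \<and>
     (\<forall>h. coset_of (tensor_null3 (scl H) (scl H) (scl H))
            (sweedler free_scale (\<lambda>(x, y).
               sweedler free_scale (\<lambda>(x1, x2). gen (x1, x2, y)) (comul H x)) (comul H h)) =
          coset_of (tensor_null3 (scl H) (scl H) (scl H))
            (sweedler free_scale (\<lambda>(x, y).
               sweedler free_scale (\<lambda>(y1, y2). gen (x, y1, y2)) (comul H y)) (comul H h))) \<and>
     (\<forall>h. sweedler (scl H) (\<lambda>(x, y). scl H (counit H x) y) (comul H h) = h \<and>
          sweedler (scl H) (\<lambda>(x, y). scl H (counit H y) x) (comul H h) = h)"

text \<open>The antipode is unique if it exists, so it need not be part of the data.\<close>

definition hopf_algebra :: "('k::comm_ring_1, 'h::ab_group_add, 'z) bialg_scheme \<Rightarrow> bool" where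
  "hopf_algebra H \<longleftrightarrow> bialgebra H \<and>
     (\<exists>S. module_hom (scl H) (scl H) S \<and>
        (\<forall>h. sweedler (scl H) (\<lambda>(x, y). mul H (S x) y) (comul H h) = scl H (counit H h) (unt H) \<and>
             sweedler (scl H) (\<lambda>(x, y). mul H x (S y)) (comul H h) = scl H (counit H h) (unt H)))"

definition comodule_algebra ::
    "('k::comm_ring_1, 'h::ab_group_add, 'z) bialg_scheme \<Rightarrow>
      ('k, 'h, 'a::ab_group_add, 'y) comod_alg_scheme \<Rightarrow> bool" where
  "comodule_algebra H A \<longleftrightarrow>
     k_algebra A \<and>
     algebra_hom_to_tensor A A H (coact A) \<and>
     (\<forall>a. coset_of (tensor_null3 (scl A) (scl H) (scl H))
            (sweedler free_scale (\<lambda>(x, h).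
               sweedler free_scale (\<lambda>(x0, x1). gen (x0, x1, h)) (coact A x)) (coact A a)) =
          coset_of (tensor_null3 (scl A) (scl H) (scl H))
            (sweedler free_scale (\<lambda>(x, h).
               sweedler free_scale (\<lambda>(h1, h2). gen (x, h1, h2)) (comul H h)) (coact A a))) \<and>
     (\<forall>a. sweedler (scl A) (\<lambda>(x, h). scl A (counit H h) x) (coact A a) = a)"

definition comodule_map ::
    "('k::comm_ring_1, 'h::ab_group_add, 'z) bialg_scheme \<Rightarrow>
      ('k, 'h, 'a::ab_group_add, 'y) comod_alg_scheme \<Rightarrow>
      ('k, 'h, 'b::ab_group_add, 'x) comod_alg_scheme \<Rightarrow> ('a \<Rightarrow> 'b) \<Rightarrow> bool" where
  "comodule_map H A C f \<longleftrightarrow>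
     module_hom (scl A) (scl C) f \<and>
     (\<forall>a. coact C (f a) = coset_of (tensor_null (scl C) (scl H))
            (sweedler free_scale (\<lambda>(x, h). gen (f x, h)) (coact A a)))"

definition coinvariants ::
    "('k::comm_ring_1, 'h::ab_group_add, 'z) bialg_scheme \<Rightarrow>
      ('k, 'h, 'a::ab_group_add, 'y) comod_alg_scheme \<Rightarrow> 'a set" where
  "coinvariants H A =
     {b. coact A b = coset_of (tensor_null (scl A) (scl H)) (gen (b, unt H))}"


section \<open>Hopf--Galois extensions and their gauge groups\<close>

text \<open>
  \<open>A \<otimes>\<^sub>B A\<close> is the quotient of \<open>A \<otimes> A\<close> by the relations \<open>ab \<otimes> a' = a \<otimes> ba'\<close> for \<open>b \<in> B\<close>.
\<close>

definition balanced_null ::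
    "('k::comm_ring_1, 'a::ab_group_add, 'z) alg_scheme \<Rightarrow> 'a set \<Rightarrow> ('a \<times> 'a \<Rightarrow>\<^sub>0 'k) set" where
  "balanced_null A B = module.span free_scale
     (tensor_relators (scl A) (scl A) \<union>
      {gen (mul A a b, a') - gen (a, mul A b a') | a b a'. b \<in> B})"

definition balanced_tensor ::
    "('k::comm_ring_1, 'a::ab_group_add, 'z) alg_scheme \<Rightarrow> 'a set \<Rightarrow>
      ('a \<times> 'a \<Rightarrow>\<^sub>0 'k) set set" where
  "balanced_tensor A B = range (coset_of (balanced_null A B))"

text \<open>The canonical map \<open>a' \<otimes>\<^sub>B a \<mapsto> a'a\<^sub>(\<^sub>0\<^sub>) \<otimes> a\<^sub>(\<^sub>1\<^sub>)\<close>.\<close>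

definition canonical_map ::
    "('k::comm_ring_1, 'h::ab_group_add, 'z) bialg_scheme \<Rightarrow>
      ('k, 'h, 'a::ab_group_add, 'y) comod_alg_scheme \<Rightarrow>
      ('a \<times> 'a \<Rightarrow>\<^sub>0 'k) set \<Rightarrow> ('a \<times> 'h \<Rightarrow>\<^sub>0 'k) set" where
  "canonical_map H A X = coset_of (tensor_null (scl A) (scl H))
     (sweedler free_scale (\<lambda>(a', a).
        sweedler free_scale (\<lambda>(a0, a1). gen (mul A a' a0, a1)) (coact A a)) X)"

definition hopf_galois ::
    "('k::comm_ring_1, 'h::ab_group_add, 'z) bialg_scheme \<Rightarrow>
      ('k, 'h, 'a::ab_group_add, 'y) comod_alg_scheme \<Rightarrow> bool" where
  "hopf_galois H A \<longleftrightarrow> comodule_algebra H A \<and>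
     bij_betw (canonical_map H A)
       (balanced_tensor A (coinvariants H A)) (tensor (scl A) (scl H))"

text \<open>\<open>Aut\<^sub>B(A)\<close> for \<open>B\<close> the coinvariants of \<open>A\<close>; note the order of the composition.\<close>

definition gauge_group ::
    "('k::comm_ring_1, 'h::ab_group_add, 'z) bialg_scheme \<Rightarrow>
      ('k, 'h, 'a::ab_group_add, 'y) comod_alg_scheme \<Rightarrow> ('a \<Rightarrow> 'a) monoid" where
  "gauge_group H A =
     \<lparr>carrier = {\<Phi>. algebra_hom A A \<Phi> \<and> comodule_map H A A \<Phi> \<and>
                   (\<forall>b \<in> coinvariants H A. \<Phi> b = b)},
      monoid.mult = (\<lambda>\<Phi> \<Psi>. \<Psi> \<circ> \<Phi>),
      one = id\<rparr>"


section \<open>Cocycles and twists\<close>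

text \<open>
  Linear maps \<open>H \<otimes> H \<rightarrow> \<k>\<close> are given as the corresponding bilinear maps on \<open>H\<close>.
\<close>

definition convolution ::
    "('k::comm_ring_1, 'h::ab_group_add, 'z) bialg_scheme \<Rightarrow>
      ('h \<Rightarrow> 'h \<Rightarrow> 'k) \<Rightarrow> ('h \<Rightarrow> 'h \<Rightarrow> 'k) \<Rightarrow> 'h \<Rightarrow> 'h \<Rightarrow> 'k" where
  "convolution H \<gamma> \<gamma>' g h =
     sweedler (*) (\<lambda>(g1, g2). sweedler (*) (\<lambda>(h1, h2). \<gamma> g1 h1 * \<gamma>' g2 h2) (comul H h)) (comul H g)"

definition convolution_inverse ::
    "('k::comm_ring_1, 'h::ab_group_add, 'z) bialg_scheme \<Rightarrow>
      ('h \<Rightarrow> 'h \<Rightarrow> 'k) \<Rightarrow> ('h \<Rightarrow> 'h \<Rightarrow> 'k) \<Rightarrow> bool" where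
  "convolution_inverse H \<gamma> \<gamma>' \<longleftrightarrow>
     module_bilinear (scl H) (scl H) (*) \<gamma>' \<and>
     (\<forall>g h. convolution H \<gamma> \<gamma>' g h = counit H g * counit H h \<and>
            convolution H \<gamma>' \<gamma> g h = counit H g * counit H h)"

definition two_cocycle ::
    "('k::comm_ring_1, 'h::ab_group_add, 'z) bialg_scheme \<Rightarrow> ('h \<Rightarrow> 'h \<Rightarrow> 'k) \<Rightarrow> bool" where
  "two_cocycle H \<gamma> \<longleftrightarrow>
     module_bilinear (scl H) (scl H) (*) \<gamma> \<and>
     (\<exists>\<gamma>'. convolution_inverse H \<gamma> \<gamma>') \<and>
     (\<forall>h. \<gamma> h (unt H) = counit H h \<and> \<gamma> (unt H) h = counit H h) \<and>
     (\<forall>g h k.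
        sweedler (*) (\<lambda>(g1, g2). sweedler (*) (\<lambda>(h1, h2).
          \<gamma> g1 h1 * \<gamma> (mul H g2 h2) k) (comul H h)) (comul H g) =
        sweedler (*) (\<lambda>(h1, h2). sweedler (*) (\<lambda>(k1, k2).
          \<gamma> h1 k1 * \<gamma> g (mul H h2 k2)) (comul H k)) (comul H h))"

text \<open>
  In the twists below, \<open>\<gamma>'\<close> is the convolution inverse of \<open>\<gamma>\<close>. The threefold coproduct is
  computed as \<open>(\<Delta> \<otimes> id)\<Delta>\<close>: \<open>h\<close> is split into \<open>x\<close> and \<open>h3\<close>, then \<open>x\<close> into \<open>h1\<close> and \<open>h2\<close>.
\<close>

definition twist_hopf ::
    "('k::comm_ring_1, 'h::ab_group_add, 'z) bialg_scheme \<Rightarrow>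
      ('h \<Rightarrow> 'h \<Rightarrow> 'k) \<Rightarrow> ('h \<Rightarrow> 'h \<Rightarrow> 'k) \<Rightarrow> ('k, 'h, 'z) bialg_scheme" where
  "twist_hopf H \<gamma> \<gamma>' = H\<lparr>mul := (\<lambda>h k.
     sweedler (scl H) (\<lambda>(x, h3). sweedler (scl H) (\<lambda>(h1, h2).
       sweedler (scl H) (\<lambda>(y, k3). sweedler (scl H) (\<lambda>(k1, k2).
         scl H (\<gamma> h1 k1 * \<gamma>' h3 k3) (mul H h2 k2))
       (comul H y)) (comul H k)) (comul H x)) (comul H h))\<rparr>"

definition twist_comod_alg ::
    "('k::comm_ring_1, 'h::ab_group_add, 'a::ab_group_add, 'y) comod_alg_scheme \<Rightarrow>
      ('h \<Rightarrow> 'h \<Rightarrow> 'k) \<Rightarrow> ('k, 'h, 'a, 'y) comod_alg_scheme" where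
  "twist_comod_alg A \<gamma>' = A\<lparr>mul := (\<lambda>a a'.
     sweedler (scl A) (\<lambda>(a0, a1). sweedler (scl A) (\<lambda>(b0, b1).
       scl A (\<gamma>' a1 b1) (mul A a0 b0)) (coact A a')) (coact A a))\<rparr>"

end

theory Submission
  imports Defs
begin

text \<open>
  The two gauge groups are equal, not merely isomorphic. Twisting changes neither the coaction nor
  the unit, so both groups consist of comodule maps that fix the same unit and the same
  coinvariants, with the same composition; only multiplicativity has to be compared. The twisted
  product \<open>a \<bullet> b = \<gamma>'(a\<^sub>(\<^sub>1\<^sub>) \<otimes> b\<^sub>(\<^sub>1\<^sub>)) a\<^sub>(\<^sub>0\<^sub>) b\<^sub>(\<^sub>0\<^sub>)\<close> is built from the old product and the coaction, so
  a comodule map that is multiplicative for the old product is multiplicative for the new one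
  (\<open>comodule_map_twist_mul\<close>). This holds for twists of any bilinear product by any bilinear form, and
  twisting \<open>\<bullet>\<close> by \<open>\<gamma>\<close> gives back the original product, by coassociativity of the coaction and
  \<open>\<gamma>' * \<gamma> = \<epsilon> \<otimes> \<epsilon>\<close> (\<open>twist_mul_untwist\<close>); hence the converse is an instance of the same lemma.

  It remains to see that \<open>Aut\<^sub>B(A)\<close> is a group, that is, that every \<open>\<Phi>\<close> in it is bijective. Write
  \<open>\<chi>\<close> for the canonical map and choose, for each \<open>h\<close>, a preimage \<open>\<Sum> x \<otimes>\<^sub>B y\<close> of \<open>1 \<otimes> h\<close>. Applying
  \<open>\<Phi>\<close> to both factors gives another preimage of \<open>1 \<otimes> h\<close>, because \<open>\<Phi>\<close> is an algebra map and a
  comodule map. As \<open>\<chi>\<close> is left \<open>A\<close>-linear, for every \<open>a\<close> the images under \<open>\<chi>\<close> of \<open>1 \<otimes>\<^sub>B a\<close> and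
  \<open>\<Sum> a\<^sub>(\<^sub>0\<^sub>) \<Phi>(x) \<otimes>\<^sub>B \<Phi>(y)\<close>, with \<open>x \<otimes>\<^sub>B y\<close> the preimage for \<open>h = a\<^sub>(\<^sub>1\<^sub>)\<close>, both equal \<open>a\<^sub>(\<^sub>0\<^sub>) \<otimes> a\<^sub>(\<^sub>1\<^sub>)\<close>.
  Injectivity of \<open>\<chi>\<close> therefore gives
  \<open>1 \<otimes>\<^sub>B a = \<Sum> a\<^sub>(\<^sub>0\<^sub>) \<Phi>(x) \<otimes>\<^sub>B \<Phi>(y)\<close> (\<open>one_tensor_eq_translation\<close>).
  Since \<open>\<Phi>\<close> fixes \<open>B\<close>, the assignment \<open>u \<otimes>\<^sub>B v \<mapsto> \<Phi>(u) v\<close> is well defined, and applying it yields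
  \<open>a = \<Phi>(\<Sum> a\<^sub>(\<^sub>0\<^sub>) \<Phi>(x) y)\<close>, so \<open>\<Phi>\<close> is surjective. Applying it instead to the same identity for the
  identity map in place of \<open>\<Phi>\<close> yields \<open>a = \<Sum> \<Phi>(a\<^sub>(\<^sub>0\<^sub>)) \<Phi>(x) y\<close>, which depends only on
  \<open>\<Phi>(a\<^sub>(\<^sub>0\<^sub>)) \<otimes> a\<^sub>(\<^sub>1\<^sub>)\<close>, the coaction of \<open>\<Phi>(a)\<close>; so \<open>\<Phi>\<close> is injective.

  Tensors are cosets in free modules. All computations are done with representatives, as linear
  extensions of maps on basis elements, and equality of tensors is equality of cosets.
\<close>

section \<open>Linear extension from a basis\<close>

definition lin_ext ::
    "('k::comm_ring_1 \<Rightarrow> 'v::ab_group_add \<Rightarrow> 'v) \<Rightarrow> ('p \<Rightarrow> 'v) \<Rightarrow> ('p \<Rightarrow>\<^sub>0 'k) \<Rightarrow> 'v" where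
  "lin_ext s f x = (\<Sum>p \<in> Poly_Mapping.keys x. s (Poly_Mapping.lookup x p) (f p))"

lemma sweedler_eq_lin_ext: "sweedler s f X = lin_ext s f (rep X)"
  by (simp add: sweedler_def lin_ext_def)

lemma lookup_free_scale [simp]:
  "Poly_Mapping.lookup (free_scale c x) p = c * Poly_Mapping.lookup x p"
  unfolding free_scale_def by (simp add: Poly_Mapping.map.rep_eq when_def)

lemma module_free_scale: "module (free_scale :: 'k::comm_ring_1 \<Rightarrow> ('p \<Rightarrow>\<^sub>0 'k) \<Rightarrow> _)"
  by unfold_locales (auto intro!: poly_mapping_eqI simp: lookup_add algebra_simps)

lemma lin_ext_superset:
  assumes "module s" "finite S" "Poly_Mapping.keys x \<subseteq> S"
  shows "lin_ext s f x = (\<Sum>p\<in>S. s (Poly_Mapping.lookup x p) (f p))"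
proof -
  interpret module s by fact
  show ?thesis
    unfolding lin_ext_def
    by (rule sum.mono_neutral_left) (use assms in \<open>auto simp: in_keys_iff\<close>)
qed

lemma module_hom_lin_ext:
  assumes "module s"
  shows "module_hom free_scale s (lin_ext s f)"
proof -
  interpret s: module s by fact
  have add: "lin_ext s f (x + y) = lin_ext s f x + lin_ext s f y" for x y
    using Poly_Mapping.keys_add[of x y]
    by (simp add: lin_ext_superset[OF assms, where S = "Poly_Mapping.keys x \<union> Poly_Mapping.keys y"]
        lookup_add s.scale_left_distrib sum.distrib)
  have scale: "lin_ext s f (free_scale c x) = s c (lin_ext s f x)" for c x
  proof -
    have "Poly_Mapping.keys (free_scale c x) \<subseteq> Poly_Mapping.keys x"
      by (auto simp: in_keys_iff)
    then show ?thesis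
      by (simp add: lin_ext_superset[OF assms, where S = "Poly_Mapping.keys x"] s.scale_sum_right)
  qed
  show ?thesis
    using module_free_scale assms add scale
    by (simp add: module_hom_def module_hom_axioms_def)
qed

lemma lin_ext_gen [simp]: "module s \<Longrightarrow> lin_ext s f (gen p) = f p"
  by (simp add: lin_ext_superset[where S = "{p}"] module.scale_one)

lemma hom_lin_ext:
  assumes "module_hom s t g"
  shows "g (lin_ext s f x) = lin_ext t (\<lambda>p. g (f p)) x"
proof -
  interpret module_hom s t g by fact
  show ?thesis by (simp add: lin_ext_def sum scale)
qed

lemma hom_sweedler:
  "module_hom s t g \<Longrightarrow> g (sweedler s f X) = sweedler t (\<lambda>p. g (f p)) X"
  by (simp add: sweedler_eq_lin_ext hom_lin_ext)

lemma lin_ext_lin_ext: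
  "module s \<Longrightarrow> lin_ext s f (lin_ext free_scale g x) = lin_ext s (\<lambda>p. lin_ext s f (g p)) x"
  by (rule hom_lin_ext[OF module_hom_lin_ext])

lemma lin_ext_basis [simp]: "lin_ext free_scale gen x = x"
proof (rule poly_mapping_eqI)
  fix q
  show "Poly_Mapping.lookup (lin_ext free_scale gen x) q = Poly_Mapping.lookup x q"
    unfolding lin_ext_def Poly_Mapping.lookup_sum
    by (simp add: lookup_single when_def in_keys_iff if_distrib cong: if_cong)
qed

lemma sweedler_swap:
  assumes "module s"
  shows "sweedler s (\<lambda>p. sweedler s (\<lambda>q. f p q) Y) X = sweedler s (\<lambda>q. sweedler s (\<lambda>p. f p q) X) Y"
proof -
  interpret module s by fact
  show ?thesis
    unfolding sweedler_def
    by (simp add: scale_sum_right) (subst sum.swap, simp add: mult.commute)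
qed

lemma module_hom_add_scale:
  assumes "module_hom s t f"
  shows "f (x + y) = f x + f y" "f (s c x) = t c (f x)"
  using assms by (simp_all add: module_hom.add module_hom.scale)

lemma module_hom_sweedler:
  assumes "module s" "module u" "\<And>p. module_hom s u (\<lambda>x. F x p)"
  shows "module_hom s u (\<lambda>x. sweedler u (F x) X)"
proof -
  interpret u: module u by fact
  show ?thesis
    using assms(1,2)
    by (simp add: module_hom_def module_hom_axioms_def sweedler_def
        module_hom_add_scale[OF assms(3)] u.scale_right_distrib sum.distrib u.scale_sum_right
        mult.commute)
qed

section \<open>Cosets and well-definedness on tensor products\<close>

lemma coset_of_eq_iff:
  assumes "module s" "module.subspace s N"
  shows "coset_of N x = coset_of N y \<longleftrightarrow> x - y \<in> N"
proof -
  interpret module s by fact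
  show ?thesis
  proof
    assume "coset_of N x = coset_of N y"
    then have "x \<in> coset_of N y" 
      unfolding coset_of_def using subspace_0[OF assms(2)] by auto
    then show "x - y \<in> N" by (simp add: coset_of_def)
  next
    assume "x - y \<in> N"
    then have "z - x \<in> N \<longleftrightarrow> z - y \<in> N" for z
      using subspace_add[OF assms(2), of "z - x" "x - y"] subspace_diff[OF assms(2), of "z - y" "x - y"]
      by auto
    then show "coset_of N x = coset_of N y" by (simp add: coset_of_def)
  qed
qed

lemma coset_of_rep:
  assumes "module s" "module.subspace s N" "X \<in> range (coset_of N)"
  shows "coset_of N (rep X) = X"
proof -
  interpret module s by fact
  obtain x where X: "X = coset_of N x" using assms(3) by blast
  have "x \<in> X" unfolding X coset_of_def using subspace_0[OF assms(2)] by simp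
  then have "rep X \<in> X" unfolding rep_def by (rule someI)
  then show ?thesis
    unfolding X by (simp add: coset_of_eq_iff[OF assms(1,2)]) (simp add: coset_of_def)
qed

text \<open>
  The form in which well-definedness on a quotient is used: a linear map sending null elements to
  null elements may be applied to both sides of an equality of cosets.
\<close>
lemma coset_of_hom_cong:
  assumes f: "module_hom s t f" and N: "module.subspace s N" and N': "module.subspace t N'"
    and sub: "f ` N \<subseteq> N'" and eq: "coset_of N x = coset_of N y"
  shows "coset_of N' (f x) = coset_of N' (f y)"
proof -
  interpret module_hom s t f by fact
  have "x - y \<in> N" using eq coset_of_eq_iff[OF m1.module_axioms N] by blast
  then have "f x - f y \<in> N'" using sub by (auto simp: diff[symmetric])
  then show ?thesis using coset_of_eq_iff[OF m2.module_axioms N'] by blast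
qed

lemma hom_image_span_subset:
  assumes f: "module_hom s t f" and N': "module.subspace t N'" and "\<And>x. x \<in> S \<Longrightarrow> f x \<in> N'"
  shows "f ` module.span s S \<subseteq> N'"
proof -
  interpret module_hom s t f by fact
  show ?thesis
    unfolding span_image[symmetric] by (rule m2.span_minimal) (use assms(3) N' in auto)
qed

text \<open>Equalities of cosets may be used under the summation sign of a Sweedler sum.\<close>
lemma lin_ext_cong_coset:
  assumes "module s" "module.subspace s N" "\<And>p. coset_of N (f p) = coset_of N (g p)"
  shows "coset_of N (lin_ext s f x) = coset_of N (lin_ext s g x)"
proof -
  interpret module s by fact
  have "f p - g p \<in> N" for p using assms by (simp add: coset_of_eq_iff)
  then have "(\<Sum>p\<in>Poly_Mapping.keys x. s (Poly_Mapping.lookup x p) (f p - g p)) \<in> N"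
    by (intro subspace_sum subspace_scale assms(2))
  then show ?thesis
    by (simp add: coset_of_eq_iff[OF assms(1,2)] lin_ext_def scale_right_diff_distrib sum_subtractf)
qed

text \<open>
  A map that is bilinear modulo \<open>N\<close> induces a linear map from the tensor product to the quotient
  by \<open>N\<close>. Maps into a second tensor product are only bilinear in this weak sense, since there the
  relations hold for cosets and not for representatives.
\<close>
lemma lin_ext_tensor_null_subset:
  assumes "module u" "module.subspace u N"
    and "\<And>x x' y. F (x + x') y - F x y - F x' y \<in> N"
    and "\<And>x y y'. F x (y + y') - F x y - F x y' \<in> N"
    and "\<And>c x y. F (s c x) y - u c (F x y) \<in> N"
    and "\<And>c x y. F x (t c y) - u c (F x y) \<in> N"
  shows "lin_ext u (\<lambda>(x, y). F x y) ` tensor_null s t \<subseteq> N"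
proof -
  interpret h: module_hom free_scale u "lin_ext u (\<lambda>(x, y). F x y)"
    by (rule module_hom_lin_ext) fact
  show ?thesis
    unfolding tensor_null_def
    by (rule hom_image_span_subset[OF h.module_hom_axioms assms(2)])
      (auto simp: tensor_relators_def h.diff h.scale assms)
qed

lemma lin_ext_tensor_null_zero:
  assumes "module_bilinear s t u F" "x \<in> tensor_null s t"
  shows "lin_ext u (\<lambda>(x, y). F x y) x = 0"
proof -
  have 1: "module_hom t u (F x)" "module_hom s u (\<lambda>x. F x y)" for x y
    using assms(1) by (auto simp: module_bilinear_def)
  interpret module_hom t u "F undefined" by (rule 1)
  have "lin_ext u (\<lambda>(x, y). F x y) ` tensor_null s t \<subseteq> {0}"
    by (rule lin_ext_tensor_null_subset)
      (use 1[THEN module_hom.add] 1[THEN module_hom.scale] in \<open>simp_all add: m2.module_axioms\<close>)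
  then show ?thesis using assms(2) by auto
qed

lemma subspace_tensor_null: "module.subspace free_scale (tensor_null s t)"
  unfolding tensor_null_def by (rule module.subspace_span[OF module_free_scale])

lemma coset_tensor_eq_iff:
  "coset_of (tensor_null s t) x = coset_of (tensor_null s t) y \<longleftrightarrow> x - y \<in> tensor_null s t"
  by (rule coset_of_eq_iff[OF module_free_scale subspace_tensor_null])

lemma lin_ext_coset_cong:
  assumes "module_bilinear s t u F" "coset_of (tensor_null s t) x = coset_of (tensor_null s t) y"
  shows "lin_ext u (\<lambda>(x, y). F x y) x = lin_ext u (\<lambda>(x, y). F x y) y"
proof -
  have "module u" using assms(1) by (auto simp: module_bilinear_def module_hom_def)
  then interpret h: module_hom free_scale u "lin_ext u (\<lambda>(x, y). F x y)"
    by (rule module_hom_lin_ext)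
  have "lin_ext u (\<lambda>(x, y). F x y) (x - y) = 0"
    using assms(2) by (intro lin_ext_tensor_null_zero[OF assms(1)]) (simp add: coset_tensor_eq_iff)
  then show ?thesis by (simp add: h.diff)
qed

text \<open>The representative chosen inside \<open>sweedler\<close> may be replaced by any other one.\<close>
lemma sweedler_coset:
  assumes "module_bilinear s t u F"
  shows "sweedler u (\<lambda>(x, y). F x y) (coset_of (tensor_null s t) x) = lin_ext u (\<lambda>(x, y). F x y) x"
  unfolding sweedler_eq_lin_ext
  by (rule lin_ext_coset_cong[OF assms]) (simp add: coset_of_rep[OF module_free_scale subspace_tensor_null])

lemma lin_ext_coset3_cong:
  assumes 1: "\<And>y z. module_hom s v (\<lambda>x. F x y z)"
    and 2: "\<And>x z. module_hom t v (\<lambda>y. F x y z)"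
    and 3: "\<And>x y. module_hom u v (\<lambda>z. F x y z)"
    and eq: "coset_of (tensor_null3 s t u) p = coset_of (tensor_null3 s t u) q"
  shows "lin_ext v (\<lambda>(x, y, z). F x y z) p = lin_ext v (\<lambda>(x, y, z). F x y z) q"
proof -
  interpret v: module v using 1 by (simp add: module_hom_def)
  interpret h: module_hom free_scale v "lin_ext v (\<lambda>(x, y, z). F x y z)"
    by (rule module_hom_lin_ext) (rule v.module_axioms)
  have sub: "lin_ext v (\<lambda>(x, y, z). F x y z) ` tensor_null3 s t u \<subseteq> {0}"
    unfolding tensor_null3_def
    by (rule hom_image_span_subset[OF h.module_hom_axioms])
      (auto simp: h.diff h.scale module_hom_add_scale[OF 1] module_hom_add_scale[OF 2]
        module_hom_add_scale[OF 3] v.module_axioms)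
  have "p - q \<in> tensor_null3 s t u"
    using eq
    by (subst (asm) coset_of_eq_iff[OF module_free_scale])
      (auto simp: tensor_null3_def intro: module.subspace_span[OF module_free_scale])
  then show ?thesis using sub h.diff[of p q] by auto
qed


lemma lin_ext_add_fun:
  "module s \<Longrightarrow> lin_ext s (\<lambda>p. f p + g p) x = lin_ext s f x + lin_ext s g x"
  by (simp add: lin_ext_def module.scale_right_distrib sum.distrib)

lemma lin_ext_scale_fun:
  "module s \<Longrightarrow> lin_ext s (\<lambda>p. s c (f p)) x = s c (lin_ext s f x)"
  by (simp add: hom_lin_ext[OF module.module_hom_scale_self])

lemma coset_add_cong:
  assumes "coset_of (tensor_null s t) x = coset_of (tensor_null s t) x'"
    and "coset_of (tensor_null s t) y = coset_of (tensor_null s t) y'"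
  shows "coset_of (tensor_null s t) (x + y) = coset_of (tensor_null s t) (x' + y')"
proof -
  have "(x - x') + (y - y') \<in> tensor_null s t"
    using assms unfolding coset_tensor_eq_iff
    by (rule module.subspace_add[OF module_free_scale subspace_tensor_null])
  then show ?thesis by (simp add: coset_tensor_eq_iff algebra_simps)
qed

lemma module_hom_free_scale: "module_hom free_scale free_scale (free_scale c)"
  by (rule module.module_hom_scale_self[OF module_free_scale])

lemma coset_scale_cong:
  assumes "coset_of (tensor_null s t) x = coset_of (tensor_null s t) x'"
  shows "coset_of (tensor_null s t) (free_scale c x) = coset_of (tensor_null s t) (free_scale c x')"
  by (rule coset_of_hom_cong[OF module_hom_free_scale subspace_tensor_null subspace_tensor_null _ assms])
    (auto intro: module.subspace_scale[OF module_free_scale subspace_tensor_null])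

lemma tensor_relators_in_null:
  "gen (x + x', y) - gen (x, y) - gen (x', y) \<in> tensor_null s t"
  "gen (x, y + y') - gen (x, y) - gen (x, y') \<in> tensor_null s t"
  "gen (s c x, y) - free_scale c (gen (x, y)) \<in> tensor_null s t"
  "gen (x, t c y) - free_scale c (gen (x, y)) \<in> tensor_null s t"
  unfolding tensor_null_def
  by (rule module.span_base[OF module_free_scale]; unfold tensor_relators_def; blast)+

subsection \<open>The map \<open>f \<otimes> id\<close>\<close>

definition map_first :: "('v \<Rightarrow> 'w) \<Rightarrow> ('v \<times> 'p \<Rightarrow>\<^sub>0 'k::comm_ring_1) \<Rightarrow> ('w \<times> 'p \<Rightarrow>\<^sub>0 'k)" where
  "map_first f = lin_ext free_scale (\<lambda>(x, h). gen (f x, h))"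

lemma module_hom_map_first: "module_hom free_scale free_scale (map_first f)"
  unfolding map_first_def by (rule module_hom_lin_ext[OF module_free_scale])

lemma map_first_gen [simp]: "map_first f (gen (x, h)) = gen (f x, h)"
  by (simp add: map_first_def module_free_scale)

lemma lin_ext_map_first:
  "module u \<Longrightarrow> lin_ext u (\<lambda>(x, h). F x h) (map_first f x) = lin_ext u (\<lambda>(x, h). F (f x) h) x"
  unfolding map_first_def by (simp add: lin_ext_lin_ext split_def)

lemma map_first_map_first: "map_first f (map_first g x) = map_first (\<lambda>z. f (g z)) x"
  unfolding map_first_def[of f] map_first_def[of "\<lambda>z. f (g z)"]
  by (rule lin_ext_map_first[OF module_free_scale])

lemma map_first_ident [simp]: "map_first (\<lambda>z. z) x = x"
  by (simp add: map_first_def case_prod_unfold)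

lemma map_first_coset_cong:
  assumes "module_hom s s' f" "coset_of (tensor_null s t) x = coset_of (tensor_null s t) y"
  shows "coset_of (tensor_null s' t) (map_first f x) = coset_of (tensor_null s' t) (map_first f y)"
proof (rule coset_of_hom_cong[OF module_hom_map_first subspace_tensor_null subspace_tensor_null _ assms(2)])
  show "map_first f ` tensor_null s t \<subseteq> tensor_null s' t"
    unfolding map_first_def
    by (rule lin_ext_tensor_null_subset[OF module_free_scale subspace_tensor_null])
      (simp_all add: module_hom_add_scale[OF assms(1)] tensor_relators_in_null)
qed

text \<open>
  Additivity in \<open>f\<close> holds only in the tensor product, not on representatives: in the free module
  the generator at \<open>(f z + g z, h)\<close> is not the sum of those at \<open>(f z, h)\<close> and \<open>(g z, h)\<close>.
\<close>
lemma map_first_add: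
  "coset_of (tensor_null s t) (map_first (\<lambda>z. f z + g z) x) =
   coset_of (tensor_null s t) (map_first f x + map_first g x)"
proof -
  have "coset_of (tensor_null s t) (map_first (\<lambda>z. f z + g z) x) =
      coset_of (tensor_null s t) (lin_ext free_scale (\<lambda>p. (\<lambda>(x, h). gen (f x, h)) p + (\<lambda>(x, h). gen (g x, h)) p) x)"
    unfolding map_first_def
    by (rule lin_ext_cong_coset[OF module_free_scale subspace_tensor_null])
      (use tensor_relators_in_null(1) in \<open>auto simp: coset_tensor_eq_iff diff_diff_eq\<close>)
  then show ?thesis by (simp add: lin_ext_add_fun module_free_scale map_first_def)
qed

lemma map_first_scale:
  "coset_of (tensor_null s t) (map_first (\<lambda>z. s c (f z)) x) =
   coset_of (tensor_null s t) (free_scale c (map_first f x))"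
proof -
  have "coset_of (tensor_null s t) (map_first (\<lambda>z. s c (f z)) x) =
      coset_of (tensor_null s t) (lin_ext free_scale (\<lambda>p. free_scale c ((\<lambda>(x, h). gen (f x, h)) p)) x)"
    unfolding map_first_def
    by (rule lin_ext_cong_coset[OF module_free_scale subspace_tensor_null])
      (use tensor_relators_in_null(3) in \<open>auto simp: coset_tensor_eq_iff\<close>)
  then show ?thesis by (simp add: lin_ext_scale_fun module_free_scale map_first_def)
qed

section \<open>Comodule algebras and the twisted product\<close>

lemma module_bilinear_hom:
  assumes "module_bilinear s t u f"
  shows "module_hom t u (f x)" "module_hom s u (\<lambda>x. f x y)"
  using assms by (auto simp: module_bilinear_def)

lemma module_hom_scale_vector:
  assumes "module_hom t (*) f" "module s"
  shows "module_hom t s (\<lambda>h. s (f h) v)"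
proof -
  interpret f: module_hom t "(*)" f by fact
  interpret s: module s by fact
  show ?thesis by unfold_locales (simp_all add: f.add f.scale s.scale_left_distrib)
qed

lemma module_hom_scaled:
  assumes "module_hom t s f"
  shows "module_hom t s (\<lambda>h. s c (f h))"
proof -
  interpret f: module_hom t s f by fact
  show ?thesis
    by unfold_locales (simp_all add: f.add f.scale f.m2.scale_right_distrib mult.commute)
qed

text \<open>
  The twist of an arbitrary product \<open>m\<close>, not necessarily that of \<open>A\<close>, so that it can be iterated:
  undoing a twist is again a twist.
\<close>
definition twist_mul ::
    "('k::comm_ring_1, 'h::ab_group_add, 'a::ab_group_add, 'y) comod_alg_scheme \<Rightarrow>
      ('h \<Rightarrow> 'h \<Rightarrow> 'k) \<Rightarrow> ('a \<Rightarrow> 'a \<Rightarrow> 'a) \<Rightarrow> 'a \<Rightarrow> 'a \<Rightarrow> 'a" where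
  "twist_mul A \<beta> m a b =
     sweedler (scl A) (\<lambda>(x, h). sweedler (scl A) (\<lambda>(y, k).
       scl A (\<beta> h k) (m x y)) (coact A b)) (coact A a)"

locale comodule_algebra_over =
  fixes H :: "('k::comm_ring_1, 'h::ab_group_add, 'z) bialg_scheme"
    and A :: "('k, 'h, 'a::ab_group_add, 'y) comod_alg_scheme"
  assumes alg_H: "k_algebra H" and comod: "comodule_algebra H A"
begin

abbreviation s where "s \<equiv> scl A"
abbreviation t where "t \<equiv> scl H"
abbreviation m where "m \<equiv> mul A"
abbreviation cls where "cls \<equiv> coset_of (tensor_null s t)"
abbreviation \<delta> where "\<delta> a \<equiv> rep (coact A a)"

lemma alg_A: "k_algebra A"
  using comod by (simp add: comodule_algebra_def)

sublocale sA: module s using alg_A by (simp add: k_algebra_def)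
sublocale tH: module t using alg_H by (simp add: k_algebra_def)

lemma bil_m: "module_bilinear s s s m" using alg_A by (simp add: k_algebra_def)
lemmas hom_m = module_bilinear_hom[OF bil_m]
lemma bil_mH: "module_bilinear t t t (mul H)" using alg_H by (simp add: k_algebra_def)
lemmas hom_mH = module_bilinear_hom[OF bil_mH]

lemma m_add_left: "m (x + x') = (\<lambda>z. m x z + m x' z)"
  and m_scale_left: "m (s c x) = (\<lambda>z. s c (m x z))"
  by (simp_all add: fun_eq_iff module_hom_add_scale[OF hom_m(2)])

lemma m_assoc: "m (m x y) z = m x (m y z)"
  and m_unit [simp]: "m (unt A) x = x" "m x (unt A) = x"
  and mH_unit [simp]: "mul H (unt H) h = h"
  using alg_A alg_H by (simp_all add: k_algebra_def)

lemma hom_to_tensor: "algebra_hom_to_tensor A A H (coact A)"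
  using comod by (simp add: comodule_algebra_def)

lemma cls_\<delta> [simp]: "cls (\<delta> a) = coact A a"
  using hom_to_tensor
  by (intro coset_of_rep[OF module_free_scale subspace_tensor_null])
    (simp add: algebra_hom_to_tensor_def linear_to_quotient_def)

lemma cls_rep [simp]: "cls (rep (cls x)) = cls x"
  by (intro coset_of_rep[OF module_free_scale subspace_tensor_null]) simp

lemma \<delta>_add: "cls (\<delta> (a + b)) = cls (\<delta> a + \<delta> b)"
  and \<delta>_scale: "cls (\<delta> (s c a)) = cls (free_scale c (\<delta> a))"
  using hom_to_tensor by (simp_all add: algebra_hom_to_tensor_def linear_to_quotient_def)

lemma module_hom_sweedler_coact:
  assumes K: "module_bilinear s t u K"
  shows "module_hom s u (\<lambda>a. sweedler u (\<lambda>(x, h). K x h) (coact A a))"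
proof -
  interpret u: module u using module_bilinear_hom(1)[OF K] by (simp add: module_hom_def)
  interpret h: module_hom free_scale u "lin_ext u (\<lambda>(x, h). K x h)"
    by (rule module_hom_lin_ext) (rule u.module_axioms)
  show ?thesis
    by unfold_locales
      (simp_all add: sweedler_eq_lin_ext lin_ext_coset_cong[OF K \<delta>_add]
        lin_ext_coset_cong[OF K \<delta>_scale] h.add h.scale)
qed

text \<open>
  For a comodule map, \<open>\<Phi>(a)\<^sub>(\<^sub>0\<^sub>) \<otimes> \<Phi>(a)\<^sub>(\<^sub>1\<^sub>) = \<Phi>(a\<^sub>(\<^sub>0\<^sub>)) \<otimes> a\<^sub>(\<^sub>1\<^sub>)\<close> may be substituted into any bilinear expression.
\<close>
lemma sweedler_comodule_map:
  assumes "comodule_map H A A \<Phi>" and K: "module_bilinear s t u K"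
  shows "sweedler u (\<lambda>(x, h). K x h) (coact A (\<Phi> a)) =
         sweedler u (\<lambda>(x, h). K (\<Phi> x) h) (coact A a)"
proof -
  have "module u" using module_bilinear_hom(1)[OF K] by (simp add: module_hom_def)
  moreover have "coact A (\<Phi> a) = cls (map_first \<Phi> (\<delta> a))"
    using assms(1) by (simp add: comodule_map_def sweedler_eq_lin_ext map_first_def)
  ultimately show ?thesis
    by (simp only: sweedler_coset[OF K] lin_ext_map_first) (simp add: sweedler_eq_lin_ext)
qed

text \<open>
  Coassociativity of the coaction for an arbitrary trilinear expression: such an expression factors
  through the threefold tensor product, in which the axiom is stated.
\<close>
lemma coassociativity:
  assumes 1: "\<And>y z. module_hom s v (\<lambda>x. F x y z)"
    and 2: "\<And>x z. module_hom t v (\<lambda>y. F x y z)"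
    and 3: "\<And>x y. module_hom t v (\<lambda>z. F x y z)"
  shows "sweedler v (\<lambda>(x, h). sweedler v (\<lambda>(x0, x1). F x0 x1 h) (coact A x)) (coact A a) =
         sweedler v (\<lambda>(x, h). sweedler v (\<lambda>(h1, h2). F x h1 h2) (comul H h)) (coact A a)"
proof -
  have v: "module v" using 1 by (simp add: module_hom_def)
  have hom: "module_hom free_scale v (lin_ext v (\<lambda>(x, y, z). F x y z))"
    by (rule module_hom_lin_ext[OF v])
  have "lin_ext v (\<lambda>(x, y, z). F x y z) (sweedler free_scale (\<lambda>(x, h).
               sweedler free_scale (\<lambda>(x0, x1). gen (x0, x1, h)) (coact A x)) (coact A a)) =
        lin_ext v (\<lambda>(x, y, z). F x y z) (sweedler free_scale (\<lambda>(x, h).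
               sweedler free_scale (\<lambda>(h1, h2). gen (x, h1, h2)) (comul H h)) (coact A a))"
    by (rule lin_ext_coset3_cong[OF 1 2 3]) (use comod in \<open>simp add: comodule_algebra_def\<close>)
  then show ?thesis
    by (simp add: hom_sweedler[OF hom, unfolded split_def] split_def lin_ext_gen[OF v])
qed

lemma counit_coact: "sweedler s (\<lambda>(x, h). s (counit H h) x) (coact A a) = a"
  using comod by (simp add: comodule_algebra_def)

context
  fixes \<beta> :: "'h \<Rightarrow> 'h \<Rightarrow> 'k" and n :: "'a \<Rightarrow> 'a \<Rightarrow> 'a"
  assumes \<beta>: "module_bilinear t t (*) \<beta>" and n: "module_bilinear s s s n"
begin

lemma bilinear_scaled_product_left: "module_bilinear s t s (\<lambda>x h. s (\<beta> h k) (n x y))"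
  unfolding module_bilinear_def
  by (intro conjI allI module_hom_scale_vector module_hom_scaled module_bilinear_hom[OF n]
      module_bilinear_hom[OF \<beta>] sA.module_axioms)

lemma bilinear_scaled_product_right: "module_bilinear s t s (\<lambda>y k. s (\<beta> h k) (n x y))"
  unfolding module_bilinear_def
  by (intro conjI allI module_hom_scale_vector module_hom_scaled module_bilinear_hom[OF n]
      module_bilinear_hom[OF \<beta>] sA.module_axioms)

lemma bilinear_twist_integrand:
  "module_bilinear s t s (\<lambda>x h. sweedler s (\<lambda>(y, k). s (\<beta> h k) (n x y)) Y)"
  unfolding module_bilinear_def
  by (intro conjI allI module_hom_sweedler sA.module_axioms tH.module_axioms)
    (auto intro: module_bilinear_hom[OF bilinear_scaled_product_left])

lemma module_bilinear_twist_mul: "module_bilinear s s s (twist_mul A \<beta> n)"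
proof -
  have "module_hom s s (\<lambda>a. twist_mul A \<beta> n a b)" for b
    unfolding twist_mul_def by (rule module_hom_sweedler_coact[OF bilinear_twist_integrand])
  moreover have "module_hom s s (\<lambda>b. twist_mul A \<beta> n a b)" for a
    unfolding twist_mul_def
    by (intro module_hom_sweedler sA.module_axioms)
      (auto intro: module_hom_sweedler_coact[OF bilinear_scaled_product_right])
  ultimately show ?thesis by (simp add: module_bilinear_def)
qed

text \<open>
  Both sides equal \<open>\<beta>(a\<^sub>(\<^sub>1\<^sub>) \<otimes> b\<^sub>(\<^sub>1\<^sub>)) n(\<Phi>(a\<^sub>(\<^sub>0\<^sub>)), \<Phi>(b\<^sub>(\<^sub>0\<^sub>)))\<close>: the twisting factor sees only the second legs of
  the coaction, which a comodule map leaves alone.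
\<close>
lemma comodule_map_twist_mul:
  assumes \<Phi>: "comodule_map H A A \<Phi>" and mult: "\<And>x y. \<Phi> (n x y) = n (\<Phi> x) (\<Phi> y)"
  shows "\<Phi> (twist_mul A \<beta> n a b) = twist_mul A \<beta> n (\<Phi> a) (\<Phi> b)"
proof -
  have hom: "module_hom s s \<Phi>" using \<Phi> by (simp add: comodule_map_def)
  have "\<Phi> (twist_mul A \<beta> n a b) =
      sweedler s (\<lambda>(x, h). sweedler s (\<lambda>(y, k). s (\<beta> h k) (n (\<Phi> x) (\<Phi> y))) (coact A b)) (coact A a)"
    by (simp add: twist_mul_def hom_sweedler[OF hom] split_def module_hom_add_scale[OF hom] mult)
  also have "\<dots> = sweedler s (\<lambda>(x, h). sweedler s (\<lambda>(y, k). s (\<beta> h k) (n (\<Phi> x) y)) (coact A (\<Phi> b))) (coact A a)"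
    by (simp add: sweedler_comodule_map[OF \<Phi> bilinear_scaled_product_right])
  also have "\<dots> = twist_mul A \<beta> n (\<Phi> a) (\<Phi> b)"
    unfolding twist_mul_def by (simp add: sweedler_comodule_map[OF \<Phi> bilinear_twist_integrand])
  finally show ?thesis .
qed

end

text \<open>
  Expanding both twists applies the coaction again to the first legs \<open>a\<^sub>(\<^sub>0\<^sub>)\<close> and \<open>b\<^sub>(\<^sub>0\<^sub>)\<close>. By
  coassociativity in \<open>b\<close> and then in \<open>a\<close> the second legs may be split instead, which gives
  \<open>\<gamma>'(a\<^sub>(\<^sub>1\<^sub>) \<otimes> b\<^sub>(\<^sub>1\<^sub>)) \<gamma>(a\<^sub>(\<^sub>2\<^sub>) \<otimes> b\<^sub>(\<^sub>2\<^sub>)) a\<^sub>(\<^sub>0\<^sub>) b\<^sub>(\<^sub>0\<^sub>)\<close>; the scalars form the convolution \<open>\<gamma>' * \<gamma> = \<epsilon> \<otimes> \<epsilon>\<close>.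
\<close>
lemma twist_mul_untwist:
  assumes \<gamma>: "module_bilinear t t (*) \<gamma>" and \<gamma>': "module_bilinear t t (*) \<gamma>'"
    and inv: "\<And>g h. convolution H \<gamma>' \<gamma> g h = counit H g * counit H h"
  shows "twist_mul A \<gamma> (twist_mul A \<gamma>' m) a b = m a b"
proof -
  let ?E = "\<lambda>x y h1 h2 k1 k2. s (\<gamma> h2 k2) (s (\<gamma>' h1 k1) (m x y))"
  have hom_E: "module_hom s s (\<lambda>x. ?E x y h1 h2 k1 k2)" "module_hom s s (\<lambda>y. ?E x y h1 h2 k1 k2)"
    "module_hom t s (\<lambda>h1. ?E x y h1 h2 k1 k2)" "module_hom t s (\<lambda>h2. ?E x y h1 h2 k1 k2)"
    "module_hom t s (\<lambda>k1. ?E x y h1 h2 k1 k2)" "module_hom t s (\<lambda>k2. ?E x y h1 h2 k1 k2)"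
    for x y h1 h2 k1 k2
    by (intro module_hom_scale_vector module_hom_scaled hom_m
      module_bilinear_hom[OF \<gamma>] module_bilinear_hom[OF \<gamma>'] sA.module_axioms)+
  \<comment> \<open>\<open>F\<close> carries the whole sum over \<open>b\<close>, so that coassociativity in \<open>a\<close> can be applied around it.\<close>
  define F where "F x h1 h2 = sweedler s (\<lambda>(y, k). sweedler s (\<lambda>(y0, y1). ?E x y0 h1 h2 y1 k)
     (coact A y)) (coact A b)" for x h1 h2
  have hom_F: "module_hom s s (\<lambda>x. F x h1 h2)" "module_hom t s (\<lambda>h1. F x h1 h2)"
    "module_hom t s (\<lambda>h2. F x h1 h2)" for x h1 h2
    unfolding F_def split_def
    by (intro module_hom_sweedler hom_E sA.module_axioms tH.module_axioms)+
  have F: "F x h1 h2 = sweedler s (\<lambda>(y, k). sweedler s (\<lambda>(k1, k2). ?E x y h1 h2 k1 k2)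
     (comul H k)) (coact A b)" for x h1 h2
    unfolding F_def by (rule coassociativity) (rule hom_E)+
  have conv: "sweedler s (\<lambda>(h1, h2). sweedler s (\<lambda>(k1, k2). ?E x y h1 h2 k1 k2) (comul H k)) (comul H h)
     = s (counit H h * counit H k) (m x y)" for x y h k
  proof -
    have "module_hom (*) s (\<lambda>c. s c (m x y))"
      by unfold_locales (simp_all add: sA.scale_left_distrib algebra_simps)
    note 1 = hom_sweedler[OF this]
    show ?thesis
      unfolding inv[symmetric] convolution_def by (simp add: 1 split_def mult.commute)
  qed
  have "twist_mul A \<gamma> (twist_mul A \<gamma>' m) a b =
    sweedler s (\<lambda>(x, h). sweedler s (\<lambda>(y, k). sweedler s (\<lambda>(x0, x1). sweedler s (\<lambda>(y0, y1).
      ?E x0 y0 x1 h y1 k) (coact A y)) (coact A x)) (coact A b)) (coact A a)"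
    by (simp add: twist_mul_def split_def hom_sweedler[OF sA.module_hom_scale_self])
  also have "\<dots> = sweedler s (\<lambda>(x, h). sweedler s (\<lambda>(x0, x1). F x0 x1 h) (coact A x)) (coact A a)"
    unfolding F_def split_def by (subst (2) sweedler_swap[OF sA.module_axioms]) (rule refl)
  also have "\<dots> = sweedler s (\<lambda>(x, h). sweedler s (\<lambda>(h1, h2). F x h1 h2) (comul H h)) (coact A a)"
    by (rule coassociativity) (rule hom_F)+
  also have "\<dots> = sweedler s (\<lambda>(x, h). sweedler s (\<lambda>(y, k). sweedler s (\<lambda>(h1, h2).
      sweedler s (\<lambda>(k1, k2). ?E x y h1 h2 k1 k2) (comul H k)) (comul H h)) (coact A b)) (coact A a)"
    unfolding F split_def by (subst (2) sweedler_swap[OF sA.module_axioms]) (rule refl)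
  also have "\<dots> = sweedler s (\<lambda>(x, h). sweedler s (\<lambda>(y, k). s (counit H h * counit H k) (m x y))
      (coact A b)) (coact A a)"
    by (simp only: conv)
  also have "\<dots> = m (sweedler s (\<lambda>(x, h). s (counit H h) x) (coact A a))
      (sweedler s (\<lambda>(y, k). s (counit H k) y) (coact A b))"
    unfolding hom_sweedler[OF hom_m(2)] unfolding hom_sweedler[OF hom_m(1)]
    by (simp add: split_def module_hom_add_scale[OF hom_m(1)] module_hom_add_scale[OF hom_m(2)]
        hom_sweedler[OF sA.module_hom_scale_self] mult.commute)
  finally show ?thesis by (simp add: counit_coact)
qed

theorem gauge_group_twist_eq:
  assumes \<gamma>: "module_bilinear t t (*) \<gamma>" and inv: "convolution_inverse H \<gamma> \<gamma>'"
  shows "gauge_group (twist_hopf H \<gamma> \<gamma>') (twist_comod_alg A \<gamma>') = gauge_group H A"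
proof -
  let ?H = "twist_hopf H \<gamma> \<gamma>'" and ?A = "twist_comod_alg A \<gamma>'"
  have \<gamma>': "module_bilinear t t (*) \<gamma>'" 
    and conv: "\<And>g h. convolution H \<gamma>' \<gamma> g h = counit H g * counit H h"
    using inv by (auto simp: convolution_inverse_def)
  have H: "scl ?H = t" "unt ?H = unt H" by (simp_all add: twist_hopf_def)
  have A: "scl ?A = s" "unt ?A = unt A" "coact ?A = coact A" "mul ?A = twist_mul A \<gamma>' m"
    by (simp_all add: twist_comod_alg_def twist_mul_def fun_eq_iff)
  have coinv: "coinvariants ?H ?A = coinvariants H A"
    by (simp add: coinvariants_def H A)
  have comod: "comodule_map ?H ?A ?A \<Phi> \<longleftrightarrow> comodule_map H A A \<Phi>" for \<Phi>
    by (simp add: comodule_map_def H A)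
  have "algebra_hom ?A ?A \<Phi> \<longleftrightarrow> algebra_hom A A \<Phi>" if \<Phi>: "comodule_map H A A \<Phi>" for \<Phi>
  proof -
    \<comment> \<open>Right to left by twisting with \<open>\<gamma>'\<close>; left to right by twisting the twisted product with \<open>\<gamma>\<close>.\<close>
    have "(\<forall>x y. \<Phi> (twist_mul A \<gamma>' m x y) = twist_mul A \<gamma>' m (\<Phi> x) (\<Phi> y)) \<longleftrightarrow>
        (\<forall>x y. \<Phi> (m x y) = m (\<Phi> x) (\<Phi> y))"
      using comodule_map_twist_mul[OF \<gamma>' bil_m \<Phi>]
        comodule_map_twist_mul[OF \<gamma> module_bilinear_twist_mul[OF \<gamma>' bil_m] \<Phi>]
      unfolding twist_mul_untwist[OF \<gamma> \<gamma>' conv] by blast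
    then show ?thesis by (simp add: algebra_hom_def A)
  qed
  then show ?thesis
    unfolding gauge_group_def coinv comod by auto
qed

end


section \<open>Gauge transformations of a Hopf--Galois extension are invertible\<close>

locale hopf_galois_extension = comodule_algebra_over H A
  for H :: "('k::comm_ring_1, 'h::ab_group_add, 'z) bialg_scheme"
    and A :: "('k, 'h, 'a::ab_group_add, 'y) comod_alg_scheme" +
  assumes galois: "bij_betw (canonical_map H A)
       (balanced_tensor A (coinvariants H A)) (tensor (scl A) (scl H))"
begin

abbreviation B where "B \<equiv> coinvariants H A"
abbreviation cls\<^sub>B where "cls\<^sub>B \<equiv> coset_of (balanced_null A B)"

text \<open>The canonical map \<open>x \<otimes> y \<mapsto> x y\<^sub>(\<^sub>0\<^sub>) \<otimes> y\<^sub>(\<^sub>1\<^sub>)\<close> on representatives.\<close>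
definition can :: "('a \<times> 'a \<Rightarrow>\<^sub>0 'k) \<Rightarrow> ('a \<times> 'h \<Rightarrow>\<^sub>0 'k)" where
  "can = lin_ext free_scale (\<lambda>(x, y). map_first (m x) (\<delta> y))"

lemma subspace_balanced_null: "module.subspace free_scale (balanced_null A B)"
  unfolding balanced_null_def by (rule module.subspace_span[OF module_free_scale])

lemma module_hom_can: "module_hom free_scale free_scale can"
  unfolding can_def by (rule module_hom_lin_ext[OF module_free_scale])

lemma can_gen [simp]: "can (gen (x, y)) = map_first (m x) (\<delta> y)"
  by (simp add: can_def module_free_scale)

lemma \<delta>_comodule_map:
  assumes "comodule_map H A A \<Phi>"
  shows "cls (\<delta> (\<Phi> a)) = cls (map_first \<Phi> (\<delta> a))"
  using assms by (simp add: comodule_map_def sweedler_eq_lin_ext map_first_def)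

text \<open>
  Left \<open>B\<close>-linearity of the coaction: the coaction is multiplicative and sends \<open>b\<close> to \<open>b \<otimes> 1\<close>. It is
  what makes the canonical map well defined on the tensor product over \<open>B\<close>.
\<close>
lemma \<delta>_mult_coinvariant:
  assumes "b \<in> B"
  shows "cls (\<delta> (m b a)) = cls (map_first (m b) (\<delta> a))"
proof -
  \<comment> \<open>\<open>F\<close> sends \<open>(x, g)\<close> to the product of \<open>x \<otimes> g\<close> with the coaction of \<open>a\<close>.\<close>
  define F where "F = (\<lambda>(x, g). lin_ext free_scale (\<lambda>(y, h). gen (m x y, mul H g h)) (\<delta> a))"
  have "cls (F (x + x', g)) = cls (F (x, g) + F (x', g))"
    and "cls (F (x, g + g')) = cls (F (x, g) + F (x, g'))"
    and "cls (F (s c x, g)) = cls (free_scale c (F (x, g)))"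
    and "cls (F (x, t c g)) = cls (free_scale c (F (x, g)))" for x x' g g' c
    unfolding F_def lin_ext_add_fun[OF module_free_scale, symmetric]
      lin_ext_scale_fun[OF module_free_scale, symmetric] prod.case
    by (rule lin_ext_cong_coset[OF module_free_scale subspace_tensor_null],
        clarsimp simp: coset_tensor_eq_iff module_hom_add_scale[OF hom_m(2)]
          module_hom_add_scale[OF hom_mH(2)] diff_diff_eq[symmetric] tensor_relators_in_null)+
  then have sub: "lin_ext free_scale (\<lambda>(x, g). F (x, g)) ` tensor_null s t \<subseteq> tensor_null s t"
    by (intro lin_ext_tensor_null_subset[OF module_free_scale subspace_tensor_null])
      (simp_all add: coset_tensor_eq_iff diff_diff_eq)
  have "cls (\<delta> (m b a)) = cls (lin_ext free_scale F (rep (cls (gen (b, unt H)))))"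
    using hom_to_tensor assms
    by (simp add: algebra_hom_to_tensor_def tensor_mul_def coinvariants_def F_def sweedler_eq_lin_ext)
  also have "\<dots> = cls (lin_ext free_scale F (gen (b, unt H)))"
    by (rule coset_of_hom_cong[OF module_hom_lin_ext[OF module_free_scale]
          subspace_tensor_null subspace_tensor_null]) (use sub in auto)
  finally show ?thesis by (simp add: F_def map_first_def module_free_scale)
qed

lemma can_balanced_null: "can ` balanced_null A B \<subseteq> tensor_null s t"
  unfolding balanced_null_def
proof (rule hom_image_span_subset[OF module_hom_can subspace_tensor_null])
  fix z
  assume "z \<in> tensor_relators s s \<union> {gen (m a b, a') - gen (a, m b a') | a b a'. b \<in> B}"
  then consider
      x x' y where "z = gen (x + x', y) - gen (x, y) - gen (x', y)"
    | x y y' where "z = gen (x, y + y') - gen (x, y) - gen (x, y')"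
    | c x y where "z = gen (s c x, y) - free_scale c (gen (x, y))"
    | c x y where "z = gen (x, s c y) - free_scale c (gen (x, y))"
    | a b a' where "z = gen (m a b, a') - gen (a, m b a')" "b \<in> B"
    unfolding tensor_relators_def by blast
  then show "can z \<in> tensor_null s t"
  proof cases
    case (1 x x' y)
    have "cls (map_first (m (x + x')) (\<delta> y)) = cls (map_first (m x) (\<delta> y) + map_first (m x') (\<delta> y))"
      using map_first_add[of s t "m x" "m x'" "\<delta> y"] by (simp add: m_add_left)
    then show ?thesis
      by (simp add: 1 module_hom.diff[OF module_hom_can] module_hom.add[OF module_hom_can] coset_tensor_eq_iff diff_diff_eq)
  next
    case (2 x y y')
    have "cls (map_first (m x) (\<delta> (y + y'))) = cls (map_first (m x) (\<delta> y) + map_first (m x) (\<delta> y'))"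
      using map_first_coset_cong[OF hom_m(1) \<delta>_add]
      by (simp add: module_hom_add_scale[OF module_hom_map_first])
    then show ?thesis
      by (simp add: 2 module_hom.diff[OF module_hom_can] module_hom.add[OF module_hom_can] coset_tensor_eq_iff diff_diff_eq)
  next
    case (3 c x y)
    have "cls (map_first (m (s c x)) (\<delta> y)) = cls (free_scale c (map_first (m x) (\<delta> y)))"
      using map_first_scale[of s t c "m x" "\<delta> y"] by (simp add: m_scale_left)
    then show ?thesis
      by (simp add: 3 module_hom.diff[OF module_hom_can] module_hom.scale[OF module_hom_can]
          coset_tensor_eq_iff)
  next
    case (4 c x y)
    have "cls (map_first (m x) (\<delta> (s c y))) = cls (free_scale c (map_first (m x) (\<delta> y)))"
      using map_first_coset_cong[OF hom_m(1) \<delta>_scale]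
      by (simp add: module_hom_add_scale[OF module_hom_map_first])
    then show ?thesis
      by (simp add: 4 module_hom.diff[OF module_hom_can] module_hom.scale[OF module_hom_can]
          coset_tensor_eq_iff)
  next
    case (5 a b a')
    have "cls (map_first (m a) (\<delta> (m b a'))) = cls (map_first (m (m a b)) (\<delta> a'))"
      using map_first_coset_cong[OF hom_m(1) \<delta>_mult_coinvariant[OF 5(2)], of a a']
      by (simp add: map_first_map_first m_assoc[symmetric])
    then show ?thesis
      by (simp add: 5 module_hom.diff[OF module_hom_can] coset_tensor_eq_iff[symmetric])
  qed
qed

lemma can_coset_cong: "cls\<^sub>B x = cls\<^sub>B y \<Longrightarrow> cls (can x) = cls (can y)"
  by (rule coset_of_hom_cong[OF module_hom_can subspace_balanced_null subspace_tensor_null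
        can_balanced_null])

lemma canonical_map_coset: "canonical_map H A (cls\<^sub>B x) = cls (can x)"
proof -
  have "canonical_map H A (cls\<^sub>B x) = cls (can (rep (cls\<^sub>B x)))"
    by (simp add: canonical_map_def sweedler_eq_lin_ext can_def map_first_def)
  also have "\<dots> = cls (can x)"
    by (rule can_coset_cong) (simp add: coset_of_rep[OF module_free_scale subspace_balanced_null])
  finally show ?thesis .
qed

lemma can_inject: "cls (can x) = cls (can y) \<Longrightarrow> cls\<^sub>B x = cls\<^sub>B y"
  using galois inj_onD[of "canonical_map H A" "balanced_tensor A B" "cls\<^sub>B x" "cls\<^sub>B y"]
  by (simp add: bij_betw_def canonical_map_coset balanced_tensor_def)

lemma can_surject: "\<exists>x. cls (can x) = cls w"
proof -
  have "cls w \<in> canonical_map H A ` balanced_tensor A B"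
    using galois by (simp add: bij_betw_def tensor_def)
  then show ?thesis by (auto simp: balanced_tensor_def canonical_map_coset)
qed

text \<open>
  A representative of the translation map \<open>h \<mapsto> \<chi>\<^sup>-\<^sup>1(1 \<otimes> h)\<close>. The choice is arbitrary for each \<open>h\<close>, so
  linearity holds only modulo the relations over \<open>B\<close>.
\<close>
definition translation :: "'h \<Rightarrow> ('a \<times> 'a \<Rightarrow>\<^sub>0 'k)" where
  "translation h = (SOME x. cls (can x) = cls (gen (unt A, h)))"

lemma can_translation: "cls (can (translation h)) = cls (gen (unt A, h))"
  unfolding translation_def by (rule someI_ex) (rule can_surject)

lemma translation_add: "cls\<^sub>B (translation (h + h')) = cls\<^sub>B (translation h + translation h')"
proof (rule can_inject)
  have "cls (can (translation h + translation h')) = cls (gen (unt A, h) + gen (unt A, h'))"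
    unfolding module_hom.add[OF module_hom_can]
    by (rule coset_add_cong) (rule can_translation)+
  also have "\<dots> = cls (gen (unt A, h + h'))"
    by (rule sym) (use tensor_relators_in_null(2) in \<open>simp add: coset_tensor_eq_iff diff_diff_eq\<close>)
  finally show "cls (can (translation (h + h'))) = cls (can (translation h + translation h'))"
    by (simp add: can_translation)
qed

lemma translation_scale: "cls\<^sub>B (translation (t c h)) = cls\<^sub>B (free_scale c (translation h))"
proof (rule can_inject)
  have "cls (can (free_scale c (translation h))) = cls (free_scale c (gen (unt A, h)))"
    unfolding module_hom.scale[OF module_hom_can]
    by (rule coset_scale_cong) (rule can_translation)
  also have "\<dots> = cls (gen (unt A, t c h))"
    by (rule sym) (use tensor_relators_in_null(4) in \<open>simp add: coset_tensor_eq_iff\<close>)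
  finally show "cls (can (translation (t c h))) = cls (can (free_scale c (translation h)))"
    by (simp add: can_translation)
qed

definition gauge :: "('a \<Rightarrow> 'a) \<Rightarrow> bool" where
  "gauge \<Phi> \<longleftrightarrow> algebra_hom A A \<Phi> \<and> comodule_map H A A \<Phi> \<and> (\<forall>b\<in>B. \<Phi> b = b)"

lemma carrier_gauge_group: "carrier (gauge_group H A) = Collect gauge"
  by (auto simp: gauge_group_def gauge_def)

lemma gaugeD:
  assumes "gauge \<Phi>"
  shows "module_hom s s \<Phi>" "\<Phi> (m x y) = m (\<Phi> x) (\<Phi> y)" "\<Phi> (unt A) = unt A"
    "comodule_map H A A \<Phi>" "b \<in> B \<Longrightarrow> \<Phi> b = b"
  using assms by (auto simp: gauge_def algebra_hom_def)

text \<open>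
  The canonical map sends both sides to the coaction of \<open>a\<close>. On the right this uses that
  \<open>z \<Phi>(x) \<otimes> \<Phi>(y)\<close> is mapped to \<open>z \<Phi>(x y\<^sub>(\<^sub>0\<^sub>)) \<otimes> y\<^sub>(\<^sub>1\<^sub>)\<close>, which sums to \<open>z \<otimes> h\<close> when \<open>\<Sum> x \<otimes> y\<close> represents
  the translation of \<open>h\<close>.
\<close>
lemma one_tensor_eq_translation:
  assumes \<Phi>: "gauge \<Phi>"
  shows "cls\<^sub>B (gen (unt A, a)) =
    cls\<^sub>B (lin_ext free_scale (\<lambda>(z, h). lin_ext free_scale (\<lambda>(x, y). gen (m z (\<Phi> x), \<Phi> y))
      (translation h)) (\<delta> a))"
proof (rule can_inject)
  have step: "cls (can (gen (m z (\<Phi> x), \<Phi> y))) =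
      cls (map_first (\<lambda>w. m z (\<Phi> w)) (can (gen (x, y))))" for x y z
  proof -
    have "cls (map_first (m (m z (\<Phi> x))) (\<delta> (\<Phi> y))) =
        cls (map_first (m (m z (\<Phi> x))) (map_first \<Phi> (\<delta> y)))"
      by (rule map_first_coset_cong[OF hom_m(1) \<delta>_comodule_map[OF gaugeD(4)[OF \<Phi>]]])
    then show ?thesis
      by (simp add: map_first_map_first gaugeD(2)[OF \<Phi>] m_assoc)
  qed
  have inner: "cls (can (lin_ext free_scale (\<lambda>(x, y). gen (m z (\<Phi> x), \<Phi> y)) (translation h))) =
      cls (gen (z, h))" for z h
  proof -
    have "cls (can (lin_ext free_scale (\<lambda>(x, y). gen (m z (\<Phi> x), \<Phi> y)) (translation h))) =
      cls (lin_ext free_scale (\<lambda>p. map_first (\<lambda>w. m z (\<Phi> w)) (can (gen p))) (translation h))"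
      unfolding hom_lin_ext[OF module_hom_can]
      by (rule lin_ext_cong_coset[OF module_free_scale subspace_tensor_null])
        (use step in \<open>simp split: prod.split\<close>)
    also have "\<dots> = cls (map_first (\<lambda>w. m z (\<Phi> w)) (can (translation h)))"
      by (simp only: hom_lin_ext[OF module_hom_can, symmetric]
          hom_lin_ext[OF module_hom_map_first, symmetric] lin_ext_basis)
    also have "\<dots> = cls (map_first (\<lambda>w. m z (\<Phi> w)) (gen (unt A, h)))"
      by (rule map_first_coset_cong[OF _ can_translation])
        (rule module_hom_compose[OF gaugeD(1)[OF \<Phi>] hom_m(1), unfolded comp_def])
    finally show ?thesis by (simp add: gaugeD(3)[OF \<Phi>])
  qed
  have "cls (can (lin_ext free_scale (\<lambda>(z, h). lin_ext free_scale (\<lambda>(x, y). gen (m z (\<Phi> x), \<Phi> y))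
      (translation h)) (\<delta> a))) = cls (lin_ext free_scale gen (\<delta> a))"
    unfolding hom_lin_ext[OF module_hom_can, of "\<lambda>(z, h). lin_ext free_scale (\<lambda>(x, y). gen (m z (\<Phi> x), \<Phi> y))
      (translation h)"]
    by (rule lin_ext_cong_coset[OF module_free_scale subspace_tensor_null])
      (use inner in \<open>simp split: prod.split\<close>)
  moreover have "m (unt A) = (\<lambda>z. z)" by (simp add: fun_eq_iff)
  ultimately show "cls (can (gen (unt A, a))) =
    cls (can (lin_ext free_scale (\<lambda>(z, h). lin_ext free_scale (\<lambda>(x, y). gen (m z (\<Phi> x), \<Phi> y))
      (translation h)) (\<delta> a)))"
    by simp
qed

definition fold_by :: "('a \<Rightarrow> 'a) \<Rightarrow> ('a \<times> 'a \<Rightarrow>\<^sub>0 'k) \<Rightarrow> 'a" where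
  "fold_by \<Phi> = lin_ext s (\<lambda>(x, y). m (\<Phi> x) y)"

lemma module_hom_fold_by: "module_hom free_scale s (fold_by \<Phi>)"
  unfolding fold_by_def by (rule module_hom_lin_ext[OF sA.module_axioms])

lemma fold_by_gen [simp]: "fold_by \<Phi> (gen (x, y)) = m (\<Phi> x) y"
  by (simp add: fold_by_def sA.module_axioms)

text \<open>
  The map \<open>x \<otimes> y \<mapsto> \<Phi>(x) y\<close> respects the relations over \<open>B\<close>, as \<open>\<Phi>(x b) y = \<Phi>(x) b y\<close> for \<open>b\<close> in \<open>B\<close>.
\<close>
lemma fold_by_coset_cong:
  assumes \<Phi>: "gauge \<Phi>" and eq: "cls\<^sub>B x = cls\<^sub>B y"
  shows "fold_by \<Phi> x = fold_by \<Phi> y"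
proof -
  interpret h: module_hom free_scale s "fold_by \<Phi>" by (rule module_hom_fold_by)
  have "fold_by \<Phi> ` balanced_null A B \<subseteq> {0}"
    unfolding balanced_null_def
    by (rule hom_image_span_subset[OF module_hom_fold_by])
      (auto simp: tensor_relators_def h.diff h.scale module_hom_add_scale[OF gaugeD(1)[OF \<Phi>]]
        module_hom_add_scale[OF hom_m(1)] module_hom_add_scale[OF hom_m(2)] gaugeD[OF \<Phi>] m_assoc)
  moreover have "x - y \<in> balanced_null A B"
    using eq coset_of_eq_iff[OF module_free_scale subspace_balanced_null] by blast
  ultimately show ?thesis using h.diff[of x y] by auto
qed

text \<open>
  Folding \<open>1 \<otimes>\<^sub>B a = \<Sum> z \<Phi>(x) \<otimes>\<^sub>B \<Phi>(y)\<close> by \<open>\<Phi>\<close> gives \<open>a = \<Sum> \<Phi>(z) \<Phi>(\<Phi>(x)) \<Phi>(y)\<close>, visibly in the image.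
\<close>
lemma gauge_surj:
  assumes \<Phi>: "gauge \<Phi>"
  shows "surj \<Phi>"
proof -
  note hom = gaugeD(1)[OF \<Phi>]
  have "\<exists>c. a = \<Phi> c" for a
  proof
    have "a = fold_by \<Phi> (gen (unt A, a))" by (simp add: gaugeD(3)[OF \<Phi>])
    also have "\<dots> = lin_ext s (\<lambda>(z, h). lin_ext s (\<lambda>(x, y). \<Phi> (m (m z (\<Phi> x)) y)) (translation h)) (\<delta> a)"
      unfolding fold_by_coset_cong[OF \<Phi> one_tensor_eq_translation[OF \<Phi>]]
      by (simp add: hom_lin_ext[OF module_hom_fold_by] split_def gaugeD(2)[OF \<Phi>])
    also have "\<dots> = \<Phi> (lin_ext s (\<lambda>(z, h). lin_ext s (\<lambda>(x, y). m (m z (\<Phi> x)) y) (translation h)) (\<delta> a))"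
      by (simp add: hom_lin_ext[OF hom] split_def)
    finally show "a = \<Phi> (lin_ext s (\<lambda>(z, h). lin_ext s (\<lambda>(x, y). m (m z (\<Phi> x)) y) (translation h)) (\<delta> a))" .
  qed
  then show ?thesis by (auto simp: surj_def)
qed

lemma gauge_id: "gauge (\<lambda>x. x)"
  using sA.module_hom_ident
  by (simp add: gauge_def algebra_hom_def comodule_map_def sweedler_eq_lin_ext
      map_first_def[symmetric])

text \<open>
  Folding \<open>1 \<otimes>\<^sub>B a = \<Sum> z x \<otimes>\<^sub>B y\<close> by \<open>\<Phi>\<close> recovers \<open>a\<close> from the coaction of \<open>\<Phi>(a)\<close>, through the linear
  map \<open>g\<close> sending \<open>h\<close> to the folded translation of \<open>h\<close>.
\<close>
lemma gauge_inj:
  assumes \<Phi>: "gauge \<Phi>"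
  shows "inj \<Phi>"
proof -
  define g where "g h = fold_by \<Phi> (translation h)" for h
  have hom_g: "module_hom t s g"
    by unfold_locales
      (simp_all add: g_def fold_by_coset_cong[OF \<Phi> translation_add]
        fold_by_coset_cong[OF \<Phi> translation_scale] module_hom_add_scale[OF module_hom_fold_by])
  have K: "module_bilinear s t s (\<lambda>z h. m z (g h))"
    unfolding module_bilinear_def
    using hom_m(2) module_hom_compose[OF hom_g hom_m(1)] by (simp add: comp_def)
  have "sweedler s (\<lambda>(z, h). m z (g h)) (coact A (\<Phi> a)) = a" for a
  proof -
    have "a = fold_by \<Phi> (gen (unt A, a))" by (simp add: gaugeD(3)[OF \<Phi>])
    also have "\<dots> = lin_ext s (\<lambda>(z, h). lin_ext s (\<lambda>(x, y). m (\<Phi> z) (m (\<Phi> x) y)) (translation h)) (\<delta> a)"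
      unfolding fold_by_coset_cong[OF \<Phi> one_tensor_eq_translation[OF gauge_id]]
      by (simp add: hom_lin_ext[OF module_hom_fold_by] split_def gaugeD(2)[OF \<Phi>] m_assoc)
    also have "\<dots> = lin_ext s (\<lambda>(z, h). m (\<Phi> z) (g h)) (\<delta> a)"
      by (simp add: g_def fold_by_def hom_lin_ext[OF hom_m(1)] split_def)
    also have "\<dots> = sweedler s (\<lambda>(z, h). m z (g h)) (coact A (\<Phi> a))"
      unfolding sweedler_comodule_map[OF gaugeD(4)[OF \<Phi>] K] by (simp add: sweedler_eq_lin_ext)
    finally show ?thesis by simp
  qed
  then show ?thesis by (rule inj_on_inverseI)
qed

lemma comodule_map_iff_map_first:
  "comodule_map H A A f \<longleftrightarrow> module_hom s s f \<and> (\<forall>a. coact A (f a) = cls (map_first f (\<delta> a)))"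
  by (simp add: comodule_map_def sweedler_eq_lin_ext map_first_def)

lemma gauge_comp:
  assumes \<Phi>: "gauge \<Phi>" and \<Psi>: "gauge \<Psi>"
  shows "gauge (\<Psi> \<circ> \<Phi>)"
proof -
  have hom: "module_hom s s (\<Psi> \<circ> \<Phi>)"
    by (rule module_hom_compose[OF gaugeD(1)[OF \<Phi>] gaugeD(1)[OF \<Psi>]])
  have "coact A (\<Psi> (\<Phi> a)) = cls (map_first (\<Psi> \<circ> \<Phi>) (\<delta> a))" for a
    using map_first_coset_cong[OF gaugeD(1)[OF \<Psi>] \<delta>_comodule_map[OF gaugeD(4)[OF \<Phi>], of a]]
      gaugeD(4)[OF \<Psi>]
    by (simp add: comodule_map_iff_map_first map_first_map_first comp_def)
  then show ?thesis
    using hom gaugeD[OF \<Phi>] gaugeD[OF \<Psi>]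
    by (simp add: gauge_def algebra_hom_def comodule_map_iff_map_first)
qed

lemma gauge_inv:
  assumes \<Phi>: "gauge \<Phi>"
  shows "gauge (inv_into UNIV \<Phi>)"
proof -
  have bij: "bij \<Phi>" using gauge_inj gauge_surj \<Phi> by (simp add: bij_def)
  have \<Phi>_inv: "\<Phi> (inv_into UNIV \<Phi> x) = x" for x by (rule surj_f_inv_f[OF gauge_surj[OF \<Phi>]])
  have inv_\<Phi>: "inv_into UNIV \<Phi> (\<Phi> x) = x" for x by (rule inv_f_f[OF gauge_inj[OF \<Phi>]])
  have hom: "module_hom s s (inv_into UNIV \<Phi>)"
    by (rule module_pair.bij_module_hom_imp_inv_module_hom[of s s, OF _ gaugeD(1)[OF \<Phi>] bij])
      (simp add: module_pair_def sA.module_axioms)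
  have mult: "inv_into UNIV \<Phi> (m x y) = m (inv_into UNIV \<Phi> x) (inv_into UNIV \<Phi> y)" for x y
    using inv_\<Phi>[of "m (inv_into UNIV \<Phi> x) (inv_into UNIV \<Phi> y)"] by (simp add: gaugeD(2)[OF \<Phi>] \<Phi>_inv)
  have *: "cls (map_first (inv_into UNIV \<Phi>) (\<delta> (\<Phi> c))) = coact A c" for c
    using map_first_coset_cong[OF hom \<delta>_comodule_map[OF gaugeD(4)[OF \<Phi>], of c]]
    by (simp add: map_first_map_first inv_\<Phi>)
  have "coact A (inv_into UNIV \<Phi> a) = cls (map_first (inv_into UNIV \<Phi>) (\<delta> a))" for a
    using *[of "inv_into UNIV \<Phi> a"] by (simp add: \<Phi>_inv)
  moreover have "inv_into UNIV \<Phi> b = b" if "b \<in> B" for b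
    using inv_\<Phi>[of b] gaugeD(5)[OF \<Phi> that] by simp
  moreover have "inv_into UNIV \<Phi> (unt A) = unt A"
    using inv_\<Phi>[of "unt A"] gaugeD(3)[OF \<Phi>] by simp
  ultimately show ?thesis
    using hom mult by (simp add: gauge_def algebra_hom_def comodule_map_iff_map_first)
qed

theorem group_gauge_group: "group (gauge_group H A)"
proof (rule groupI; unfold carrier_gauge_group mem_Collect_eq)
  fix \<Phi> assume \<Phi>: "gauge \<Phi>"
  have "inv_into UNIV \<Phi> \<otimes>\<^bsub>gauge_group H A\<^esub> \<Phi> = \<one>\<^bsub>gauge_group H A\<^esub>"
    using surj_iff[of \<Phi>] gauge_surj[OF \<Phi>] by (simp add: gauge_group_def)
  then show "\<exists>\<Psi>\<in>Collect gauge. \<Psi> \<otimes>\<^bsub>gauge_group H A\<^esub> \<Phi> = \<one>\<^bsub>gauge_group H A\<^esub>"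
    using gauge_inv[OF \<Phi>] by blast
qed (use gauge_comp gauge_id in \<open>auto simp: gauge_group_def id_def comp_assoc\<close>)

end

theorem proposition6p4:
  fixes H :: "('k::comm_ring_1, 'h::ab_group_add) bialg"
    and A :: "('k, 'h, 'a::ab_group_add) comod_alg"
    and \<gamma> \<gamma>' :: "'h \<Rightarrow> 'h \<Rightarrow> 'k"
  assumes "field_or_power_series TYPE('k) TYPE('f::field)"
    and "hopf_algebra H"
    and "hopf_galois H A"
    and "two_cocycle H \<gamma>"
    and "convolution_inverse H \<gamma> \<gamma>'"
  shows "group (gauge_group (twist_hopf H \<gamma> \<gamma>') (twist_comod_alg A \<gamma>')) \<and>
         group (gauge_group H A) \<and>
         gauge_group (twist_hopf H \<gamma> \<gamma>') (twist_comod_alg A \<gamma>') \<cong> gauge_group H A"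
proof -
  interpret hopf_galois_extension H A
    by unfold_locales
      (use assms in \<open>simp_all add: hopf_algebra_def bialgebra_def hopf_galois_def\<close>)
  have "gauge_group (twist_hopf H \<gamma> \<gamma>') (twist_comod_alg A \<gamma>') = gauge_group H A"
    using assms by (intro gauge_group_twist_eq) (simp_all add: two_cocycle_def)
  then show ?thesis
    using group_gauge_group by (simp add: iso_refl)
qed

end
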